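(* Let $G=(V,E)$ be a finite connected multigraph without self-loops and with at least one edge. Let $\mu^*$ be an optimal pmf for the MEO problem on $\Gamma_G$ and let $\eta^*(e)=\sum_{\gamma\in\Gamma_G,\,e\in\gamma}\mu^*(\gamma)$ for $e\in E$. Define $K:=\max_{e\in E}\eta^*(e)$ and $E^*=\{e\in E:\eta^*(e)=K\}$. Then there exists a feasible partition $P^*$ of $G$ such that 1. $E^*=E_{P^*}$; 2. $|\gamma^*\cap E_{P^*}|=k_{P^*}-1$ for all $\gamma^*\in\operatorname{supp}\mu^*$; 3. $\eta^*(e)=K=w(P^* )^{-1}$ for all $e\in E_{P^*}$; 4. $w(P^* )=\min\{w(P):P\text{ is a feasible partition of }G\}$.
   Context: $\Gamma_G$ is the set of spanning trees of $G$ (as subsets of $E$), $\mathcal{P}(\Gamma_G)$ the set of probability mass functions (pmfs) on it. The MEO problem is to minimize $\sum_{\gamma,\gamma'\in\Gamma_G}|\gamma\cap\gamma'|\,\mu(\gamma)\mu(\gamma')$ over $\mu\in\mathcal{P}(\Gamma_G)$; a minimizer is called optimal. A feasible partition $P$ of $G$ is a partition $\{V_1,\dots,V_{k_P}\}$ of $V$ into $k_P\ge2$ (nonempty) parts such that each induced subgraph $G(V_i)$ is connected; $E_P$ is the set of edges of $G$ connecting vertices in different parts. The weight of $P$ is $w(P)=\frac{|E_P|}{k_P-1}$. *)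

theory Defs
  imports "HOL-Probability.Probability_Mass_Function" "HOL-Library.Disjoint_Sets"
begin

text \<open>
  Undirected multigraphs: edges are abstract objects, so that parallel edges are distinct
  elements of \<open>edges G\<close>; \<open>ends G e\<close> is the set of endpoints of \<open>e\<close>, a singleton
  exactly if \<open>e\<close> is a self-loop.
\<close>

record ('v, 'e) multigraph =
  verts :: "'v set"
  edges :: "'e set"
  ends :: "'e \<Rightarrow> 'v set"

definition wf_multigraph :: "('v, 'e) multigraph \<Rightarrow> bool" where
  "wf_multigraph G \<longleftrightarrow> (\<forall>e\<in>edges G. ends G e \<subseteq> verts G \<and> card (ends G e) \<in> {1, 2})"

definition finite_multigraph :: "('v, 'e) multigraph \<Rightarrow> bool" where
  "finite_multigraph G \<longleftrightarrow> wf_multigraph G \<and> finite (verts G) \<and> finite (edges G)"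

definition loopless :: "('v, 'e) multigraph \<Rightarrow> bool" where
  "loopless G \<longleftrightarrow> (\<forall>e\<in>edges G. card (ends G e) \<noteq> 1)"

definition adjacent :: "('v, 'e) multigraph \<Rightarrow> 'v \<Rightarrow> 'v \<Rightarrow> bool" where
  "adjacent G u v \<longleftrightarrow> (\<exists>e\<in>edges G. ends G e = {u, v})"

definition graph_connected :: "('v, 'e) multigraph \<Rightarrow> bool" where
  "graph_connected G \<longleftrightarrow>
     verts G \<noteq> {} \<and> (\<forall>u\<in>verts G. \<forall>v\<in>verts G. (adjacent G)\<^sup>*\<^sup>* u v)"

text \<open>
  The cycle with vertices \<open>vs\<close> and edges \<open>es\<close>, the \<open>i\<close>-th edge joining the \<open>i\<close>-th vertex
  to its cyclic successor. Length 1 is a self-loop, length 2 a pair of parallel edges.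
\<close>
definition graph_cycle :: "('v, 'e) multigraph \<Rightarrow> 'v list \<Rightarrow> 'e list \<Rightarrow> bool" where
  "graph_cycle G vs es \<longleftrightarrow>
     es \<noteq> [] \<and> length vs = length es \<and> distinct vs \<and> distinct es \<and>
     set vs \<subseteq> verts G \<and> set es \<subseteq> edges G \<and>
     (\<forall>i<length es. ends G (es ! i) = {vs ! i, vs ! (Suc i mod length es)})"

definition acyclic_graph :: "('v, 'e) multigraph \<Rightarrow> bool" where
  "acyclic_graph G \<longleftrightarrow> (\<nexists>vs es. graph_cycle G vs es)"

definition graph_tree :: "('v, 'e) multigraph \<Rightarrow> bool" where
  "graph_tree G \<longleftrightarrow> graph_connected G \<and> acyclic_graph G"

definition spanning_trees :: "('v, 'e) multigraph \<Rightarrow> 'e set set" where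
  "spanning_trees G = {\<gamma>. \<gamma> \<subseteq> edges G \<and> graph_tree (G\<lparr>edges := \<gamma>\<rparr>)}"

definition pmfs_on :: "'a set \<Rightarrow> 'a pmf set" where
  "pmfs_on A = {\<mu>. set_pmf \<mu> \<subseteq> A}"

definition expected_overlap :: "('v, 'e) multigraph \<Rightarrow> 'e set pmf \<Rightarrow> real" where
  "expected_overlap G \<mu> =
     (\<Sum>\<gamma>\<in>spanning_trees G. \<Sum>\<gamma>'\<in>spanning_trees G.
        real (card (\<gamma> \<inter> \<gamma>')) * pmf \<mu> \<gamma> * pmf \<mu> \<gamma>')"

definition meo_optimal :: "('v, 'e) multigraph \<Rightarrow> 'e set pmf \<Rightarrow> bool" where
  "meo_optimal G \<mu> \<longleftrightarrow>
     is_arg_min (expected_overlap G) (\<lambda>\<nu>. \<nu> \<in> pmfs_on (spanning_trees G)) \<mu>"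

definition edge_prob :: "('v, 'e) multigraph \<Rightarrow> 'e set pmf \<Rightarrow> 'e \<Rightarrow> real" where
  "edge_prob G \<mu> e = (\<Sum>\<gamma> | \<gamma> \<in> spanning_trees G \<and> e \<in> \<gamma>. pmf \<mu> \<gamma>)"

definition induced_subgraph :: "('v, 'e) multigraph \<Rightarrow> 'v set \<Rightarrow> ('v, 'e) multigraph" where
  "induced_subgraph G U = G\<lparr>verts := U, edges := {e \<in> edges G. ends G e \<subseteq> U}\<rparr>"

definition feasible_partition :: "('v, 'e) multigraph \<Rightarrow> 'v set set \<Rightarrow> bool" where
  "feasible_partition G P \<longleftrightarrow>
     partition_on (verts G) P \<and> card P \<ge> 2 \<and>
     (\<forall>U\<in>P. graph_connected (induced_subgraph G U))"

definition cut_edges :: "('v, 'e) multigraph \<Rightarrow> 'v set set \<Rightarrow> 'e set" where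
  "cut_edges G P =
     {e \<in> edges G. \<exists>U\<in>P. \<exists>W\<in>P. U \<noteq> W \<and> (\<exists>u\<in>U. \<exists>w\<in>W. ends G e = {u, w})}"

definition partition_weight :: "('v, 'e) multigraph \<Rightarrow> 'v set set \<Rightarrow> real" where
  "partition_weight G P = real (card (cut_edges G P)) / (real (card P) - 1)"

end

theory Submission
  imports Defs
begin

text \<open>
  Write \<open>\<eta>\<close> for the edge probabilities of the optimal pmf \<open>\<mu>\<close>. The expected overlap equals
  \<open>\<Sum>e. (\<eta> e)\<^sup>2\<close> (\<open>expected_overlap_eq\<close>). Let \<open>\<gamma>\<close> be a tree in the support of \<open>\<mu>\<close>, and
  let an exchange of \<open>e \<in> \<gamma>\<close> for \<open>d \<notin> \<gamma>\<close> give another spanning tree. Moving a small mass \<open>t\<close>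
  to the new tree lowers \<open>\<eta> e\<close> and raises \<open>\<eta> d\<close> by \<open>t\<close>, so it changes the overlap by
  \<open>2 * t * (t - (\<eta> e - \<eta> d))\<close>. Optimality therefore forces \<open>\<eta> e \<le> \<eta> d\<close>
  (\<open>optimal_exchange\<close>): the trees in the support are minimum spanning trees for the weights \<open>\<eta>\<close>.

  Let \<open>F\<close> be the set of edges on which \<open>\<eta>\<close> is less than its maximum \<open>K\<close>, and let \<open>P\<close> be the
  partition into the components of \<open>F\<close>. As in Kruskal's algorithm, a minimum spanning tree
  restricted to \<open>F\<close> already connects whatever \<open>F\<close> connects; otherwise an edge of weight
  \<open>K\<close> could be exchanged for one of \<open>F\<close> (\<open>spanning_tree_exchange\<close>). Two consequences follow.
  An edge of weight \<open>K\<close> lies in some tree of the support, because \<open>K > 0\<close>, and it would close a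
  cycle there if both its ends were in one component; so the edges of weight \<open>K\<close> are exactly the
  cut edges of \<open>P\<close>. Moreover every tree of the support has exactly \<open>card P - 1\<close> cut
  edges, because each of them joins two components (\<open>card_components_forest_Un\<close>).

  Averaging this count over \<open>\<mu>\<close> gives \<open>K * card (cut_edges G P) = card P - 1\<close>. For any other
  partition \<open>Q\<close>, each spanning tree has at least \<open>card Q - 1\<close> cut edges
  (\<open>card_tree_cut_ge\<close>), and the same average gives
  \<open>card Q - 1 \<le> K * card (cut_edges G Q)\<close>. Hence \<open>1 / K\<close> is the weight of \<open>P\<close> and a lower
  bound for all weights.
\<close>

section \<open>Moving mass between two points of a pmf\<close>

lemma pmf_transfer_mass:
  fixes p :: "'a pmf"
  assumes "finite (set_pmf p)" "x \<noteq> y" "0 \<le> t" "t \<le> pmf p x"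
  obtains q where "\<And>z. pmf q z = pmf p z - of_bool (z = x) * t + of_bool (z = y) * t"
    and "set_pmf q \<subseteq> insert y (set_pmf p)"
proof -
  define g where "g z = pmf p z - of_bool (z = x) * t + of_bool (z = y) * t" for z
  have nonneg: "g z \<ge> 0" for z
    using assms by (auto simp: g_def)
  let ?A = "insert x (insert y (set_pmf p))"
  have fin: "finite ?A" using assms by simp
  have zero: "g z = 0" if "z \<notin> ?A" for z using that by (auto simp: g_def set_pmf_iff)
  have "(\<Sum>z\<in>?A. g z) = (\<Sum>z\<in>?A. pmf p z) - (\<Sum>z\<in>?A. of_bool (z = x) * t) + (\<Sum>z\<in>?A. of_bool (z = y) * t)"
    by (simp only: g_def sum.distrib sum_subtractf)
  also have "(\<Sum>z\<in>?A. pmf p z) = 1" using fin by (intro sum_pmf_eq_1) auto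
  also have "(\<Sum>z\<in>?A. of_bool (z = x) * t) = t"
    using fin by (subst sum.mono_neutral_right[of ?A "{x}"]) auto
  also have "(\<Sum>z\<in>?A. of_bool (z = y) * t) = t"
    using fin by (subst sum.mono_neutral_right[of ?A "{y}"]) auto
  finally have "(\<Sum>z\<in>?A. g z) = 1" by simp
  moreover have "(\<integral>\<^sup>+z. ennreal (g z) \<partial>count_space UNIV) = (\<Sum>z\<in>?A. ennreal (g z))"
    using fin zero nonneg by (intro nn_integral_count_space') auto
  ultimately have "(\<integral>\<^sup>+z. ennreal (g z) \<partial>count_space UNIV) = 1"
    using nonneg by (simp add: sum_ennreal)
  then have q: "pmf (embed_pmf g) z = g z" for z
    using nonneg by (intro pmf_embed_pmf)
  show ?thesis
  proof (rule that[of "embed_pmf g"])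
    show "pmf (embed_pmf g) z = pmf p z - of_bool (z = x) * t + of_bool (z = y) * t" for z
      by (simp add: q g_def)
    show "set_pmf (embed_pmf g) \<subseteq> insert y (set_pmf p)"
    proof
      fix z assume "z \<in> set_pmf (embed_pmf g)"
      then have "g z \<noteq> 0" by (simp add: set_pmf_iff q)
      then show "z \<in> insert y (set_pmf p)"
        using assms by (auto simp: g_def set_pmf_iff split: if_splits)
    qed
  qed
qed

section \<open>Linking by a set of edges\<close>

definition linked :: "('v, 'e) multigraph \<Rightarrow> 'e set \<Rightarrow> 'v \<Rightarrow> 'v \<Rightarrow> bool" where
  "linked G F = (adjacent (G\<lparr>edges := F\<rparr>))\<^sup>*\<^sup>*"

lemma adjacent_edges_iff: "adjacent (G\<lparr>edges := F\<rparr>) u v \<longleftrightarrow> (\<exists>e\<in>F. ends G e = {u, v})"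
  by (simp add: adjacent_def)

lemma linked_refl [simp]: "linked G F x x"
  by (simp add: linked_def)

lemma linked_trans: "linked G F x y \<Longrightarrow> linked G F y z \<Longrightarrow> linked G F x z"
  by (simp add: linked_def)

lemma linked_sym: "linked G F x y \<Longrightarrow> linked G F y x"
proof -
  have "symp (adjacent (G\<lparr>edges := F\<rparr>))"
    by (auto simp: symp_def adjacent_edges_iff insert_commute)
  then show "linked G F x y \<Longrightarrow> linked G F y x"
    unfolding linked_def using sympD symp_rtranclp by metis
qed

lemma linked_edge: "e \<in> F \<Longrightarrow> ends G e = {u, v} \<Longrightarrow> linked G F u v"
  unfolding linked_def by (rule r_into_rtranclp) (auto simp: adjacent_edges_iff)

lemma linked_induct [consumes 1, case_names refl step]:
  assumes "linked G F x y" and "P x"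
    and "\<And>y z e. linked G F x y \<Longrightarrow> P y \<Longrightarrow> e \<in> F \<Longrightarrow> ends G e = {y, z} \<Longrightarrow> P z"
  shows "P y"
  using assms(1) unfolding linked_def
proof (induction rule: rtranclp_induct)
  case base
  show ?case by (fact assms(2))
next
  case (step y z)
  then show ?case
    using assms(3) unfolding linked_def adjacent_edges_iff by blast
qed

text \<open>
  A path in \<open>F\<close> can be rerouted through \<open>F'\<close> edge by edge. This is how both enlarging the edge set
  and exchanging edges are seen to preserve connections.
\<close>
lemma linked_if_edges_linked:
  assumes "linked G F x y"
    and "\<And>e u v. e \<in> F \<Longrightarrow> ends G e = {u, v} \<Longrightarrow> linked G F' u v"
  shows "linked G F' x y"
  using assms(1)
  by (induction rule: linked_induct) (auto intro: linked_trans assms(2))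

lemma linked_mono: "linked G F x y \<Longrightarrow> F \<subseteq> F' \<Longrightarrow> linked G F' x y"
  by (erule linked_if_edges_linked) (blast intro: linked_edge)

text \<open>
  A connection that needs the new edge can be chosen to traverse it once, in one of its two
  directions. Bridges, forests, exchanges and component counts are all analysed with this rule,
  so that paths as lists occur only in the comparison with cycles.
\<close>
lemma linked_insert:
  assumes "ends G e = {u, v}"
  shows "linked G (insert e F) x y \<longleftrightarrow>
    linked G F x y \<or> linked G F x u \<and> linked G F v y \<or> linked G F x v \<and> linked G F u y"
    (is "_ \<longleftrightarrow> ?R y")
proof
  show "?R y" if "linked G (insert e F) x y"
    using that
  proof (induction rule: linked_induct)
    case (step y z d)
    show ?case
    proof (cases "d \<in> F")
      case True
      then show ?thesis
        using step linked_edge linked_trans by metis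
    next
      case False
      then have "y = u \<and> z = v \<or> y = v \<and> z = u"
        using step assms by (auto simp: doubleton_eq_iff)
      then show ?thesis
        using step.IH linked_refl linked_trans by metis
    qed
  qed simp
next
  have uv: "linked G (insert e F) u v"
    using assms by (auto intro: linked_edge)
  have "linked G F a b \<Longrightarrow> linked G (insert e F) a b" for a b
    by (erule linked_mono) blast
  then show "?R y \<Longrightarrow> linked G (insert e F) x y"
    using uv linked_sym linked_trans by metis
qed

definition component :: "('v, 'e) multigraph \<Rightarrow> 'e set \<Rightarrow> 'v \<Rightarrow> 'v set" where
  "component G F x = {y \<in> verts G. linked G F x y}"

definition components :: "('v, 'e) multigraph \<Rightarrow> 'e set \<Rightarrow> 'v set set" where
  "components G F = component G F ` verts G"

lemma component_eq_iff:
  "y \<in> verts G \<Longrightarrow> component G F x = component G F y \<longleftrightarrow> linked G F x y"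
  unfolding component_def using linked_refl linked_sym linked_trans
  by (smt (verit) Collect_cong mem_Collect_eq)

lemma component_of_member:
  assumes "U \<in> components G F" "x \<in> U"
  shows "U = component G F x"
proof -
  obtain y where "U = component G F y" using assms by (auto simp: components_def)
  moreover from this have "x \<in> verts G" "linked G F y x"
    using assms by (auto simp: component_def)
  ultimately show ?thesis using component_eq_iff by metis
qed

lemma partition_on_components: "partition_on (verts G) (components G F)"
proof (rule partition_onI)
  show "\<Union> (components G F) = verts G"
    by (auto simp: components_def component_def)
  show "{} \<notin> components G F"
    by (auto simp: components_def component_def)
  show "disjnt A B" if "A \<in> components G F" "B \<in> components G F" "A \<noteq> B" for A B
  proof (rule ccontr)
    assume "\<not> disjnt A B"
    then obtain z where "z \<in> A" "z \<in> B" by (auto simp: disjnt_def)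
    then show False using that component_of_member by metis
  qed
qed

lemma components_cong:
  assumes "\<And>x y. x \<in> verts G \<Longrightarrow> y \<in> verts G \<Longrightarrow> linked G F x y \<longleftrightarrow> linked G F' x y"
  shows "components G F = components G F'"
  unfolding components_def component_def using assms by (intro image_cong) auto

lemma card_components_eq_1:
  assumes "graph_connected (G\<lparr>edges := F\<rparr>)"
  shows "card (components G F) = 1"
proof -
  obtain x where x: "x \<in> verts G" using assms by (auto simp: graph_connected_def)
  have "component G F y = verts G" if "y \<in> verts G" for y
    using assms that by (auto simp: component_def graph_connected_def linked_def)
  then have "components G F = {verts G}"
    using x by (auto simp: components_def)
  then show ?thesis by simp
qed

text \<open>
  The new edge merges the components of its two ends, which are different, and leaves all others
  as they are.
\<close>
lemma card_components_insert_bridge: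
  assumes fin: "finite (verts G)" and e: "ends G e = {u, v}"
    and uv: "u \<in> verts G" "v \<in> verts G" and nl: "\<not> linked G F u v"
  shows "card (components G F) = Suc (card (components G (insert e F)))"
proof -
  let ?A = "component G F u" and ?B = "component G F v" and ?C = "components G F"
  have finC: "finite ?C" using fin by (simp add: components_def)
  have AB: "?A \<in> ?C" "?B \<in> ?C" "?A \<noteq> ?B"
    using uv nl component_eq_iff[OF uv(2), of F u] by (auto simp: components_def)
  have new: "component G (insert e F) x =
      (if linked G F x u \<or> linked G F x v then ?A \<union> ?B else component G F x)" for x
  proof -
    have "linked G (insert e F) x y \<longleftrightarrow>
        (if linked G F x u \<or> linked G F x v then linked G F u y \<or> linked G F v y else linked G F x y)" for y
      using linked_insert[OF e, of F x y] linked_trans[of G F] linked_sym[of G F] by metis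
    then show ?thesis by (auto simp: component_def)
  qed
  have keep: "\<not> linked G F x u \<and> \<not> linked G F x v \<longleftrightarrow> component G F x \<noteq> ?A \<and> component G F x \<noteq> ?B" for x
    using component_eq_iff uv by metis
  have eq: "components G (insert e F) = insert (?A \<union> ?B) (?C - {?A, ?B})"
  proof (intro subset_antisym subsetI)
    fix X assume "X \<in> components G (insert e F)"
    then obtain x where "x \<in> verts G" "X = component G (insert e F) x"
      by (auto simp: components_def)
    then show "X \<in> insert (?A \<union> ?B) (?C - {?A, ?B})"
      using new[of x] keep[of x] by (auto simp: components_def)
  next
    fix X assume X: "X \<in> insert (?A \<union> ?B) (?C - {?A, ?B})"
    show "X \<in> components G (insert e F)"
    proof (cases "X = ?A \<union> ?B")
      case True
      then show ?thesis using new[of u] uv by (auto simp: components_def)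
    next
      case False
      then obtain x where "x \<in> verts G" "X = component G F x" "X \<noteq> ?A" "X \<noteq> ?B"
        using X by (auto simp: components_def)
      then show ?thesis using new[of x] keep[of x] by (auto simp: components_def)
    qed
  qed
  have "?A \<union> ?B \<notin> ?C"
  proof
    assume "?A \<union> ?B \<in> ?C"
    then obtain x where x: "x \<in> verts G" "?A \<union> ?B = component G F x"
      by (auto simp: components_def)
    have "u \<in> component G F x" "v \<in> component G F x"
      using uv unfolding x(2)[symmetric] by (auto simp: component_def)
    then show False using nl linked_sym linked_trans by (metis (mono_tags) component_def mem_Collect_eq)
  qed
  then have "card (components G (insert e F)) = Suc (card (?C - {?A, ?B}))"
    using eq finC by simp
  moreover have "card (?C - {?A, ?B}) = card ?C - 2"
    using AB finC by (subst card_Diff_subset) auto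
  moreover have "card ?C \<ge> 2"
    using AB finC card_mono[of ?C "{?A, ?B}"] by simp
  ultimately show ?thesis by simp
qed

section \<open>Acyclic edge sets\<close>

text \<open>
  The requirement is that every edge is a bridge. By \<open>acyclic_imp_forest\<close> and
  \<open>forest_imp_acyclic\<close> this is the absence of cycles, in a form that fits \<open>linked_insert\<close>.
\<close>
definition forest :: "('v, 'e) multigraph \<Rightarrow> 'e set \<Rightarrow> bool" where
  "forest G F \<longleftrightarrow> (\<forall>e\<in>F. \<forall>u v. ends G e = {u, v} \<longrightarrow> \<not> linked G (F - {e}) u v)"

lemma forest_subset: "forest G F \<Longrightarrow> F' \<subseteq> F \<Longrightarrow> forest G F'"
  unfolding forest_def by (meson Diff_mono linked_mono order_refl subsetD)

text \<open>
  If an old edge \<open>e\<close> stopped being a bridge, then its ends would be connected through \<open>d\<close>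
  without \<open>e\<close>; following that connection and closing it with \<open>e\<close> instead of \<open>d\<close> would already
  link the ends of \<open>d\<close> in \<open>F\<close>.
\<close>
lemma forest_insert:
  assumes F: "forest G F" and d: "ends G d = {a, b}" and nl: "\<not> linked G F a b"
  shows "forest G (insert d F)"
  unfolding forest_def
proof (intro ballI allI impI notI)
  fix e u v
  assume e: "e \<in> insert d F" "ends G e = {u, v}" and l: "linked G (insert d F - {e}) u v"
  show False
  proof (cases "e = d")
    case True
    then have "linked G F u v" using l by (rule_tac linked_mono) auto
    then show False
      using nl True d e linked_sym by (metis doubleton_eq_iff)
  next
    case False
    have sub: "linked G (F - {e}) x y \<Longrightarrow> linked G F x y" for x y
      by (erule linked_mono) blast
    have eF: "e \<in> F" using e False by blast
    have uv: "linked G F u v" using eF e by (auto intro: linked_edge)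
    have "insert d F - {e} = insert d (F - {e})" using False by blast
    then have "linked G (F - {e}) u a \<and> linked G (F - {e}) b v \<or>
        linked G (F - {e}) u b \<and> linked G (F - {e}) a v"
      using l F eF e(2) linked_insert[OF d] by (metis forest_def)
    then have "linked G F a b"
      using sub uv linked_sym linked_trans by metis
    then show False using nl by simp
  qed
qed

lemma linked_imp_simple_path:
  assumes "linked G F u v"
  shows "\<exists>vs. vs \<noteq> [] \<and> hd vs = u \<and> last vs = v \<and> distinct vs \<and>
    successively (adjacent (G\<lparr>edges := F\<rparr>)) vs"
  using assms
proof (induction rule: linked_induct)
  case refl
  show ?case by (rule exI[of _ "[u]"]) simp
next
  case (step y z e)
  \<comment> \<open>If the path has already met \<open>z\<close>, it is cut back to that visit instead of being extended.\<close>
  then obtain vs where vs: "vs \<noteq> []" "hd vs = u" "last vs = y" "distinct vs"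
    "successively (adjacent (G\<lparr>edges := F\<rparr>)) vs" by blast
  show ?case
  proof (cases "z \<in> set vs")
    case True
    then obtain ps qs where "vs = (ps @ [z]) @ qs" by (auto dest: split_list)
    moreover from this have "hd (ps @ [z]) = u" using vs by (cases ps) auto
    ultimately show ?thesis
      using vs by (intro exI[of _ "ps @ [z]"]) (auto simp: successively_append_iff)
  next
    case False
    have "adjacent (G\<lparr>edges := F\<rparr>) y z" using step by (auto simp: adjacent_edges_iff)
    then show ?thesis
      using vs False by (intro exI[of _ "vs @ [z]"]) (auto simp: successively_append_iff)
  qed
qed

locale finite_loopless_multigraph =
  fixes G :: "('v, 'e) multigraph"
  assumes finite: "finite_multigraph G" and loopless: "loopless G"
begin

lemma finite_verts: "finite (verts G)" and finite_edges: "finite (edges G)"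
  using finite by (auto simp: finite_multigraph_def)

lemma edge_ends:
  assumes "e \<in> edges G"
  obtains u v where "ends G e = {u, v}" "u \<noteq> v" "u \<in> verts G" "v \<in> verts G"
proof -
  have "card (ends G e) = 2" "ends G e \<subseteq> verts G"
    using assms finite loopless
    by (auto simp: finite_multigraph_def wf_multigraph_def loopless_def)
  then show ?thesis using that by (auto simp: card_2_iff)
qed

lemma ends_in_verts: "e \<in> edges G \<Longrightarrow> ends G e = {u, v} \<Longrightarrow> u \<in> verts G \<and> v \<in> verts G"
  by (erule edge_ends) (auto simp: doubleton_eq_iff)

lemma ends_distinct: "e \<in> edges G \<Longrightarrow> ends G e = {u, v} \<Longrightarrow> u \<noteq> v"
  by (erule edge_ends) auto

text \<open>
  If the ends of \<open>e\<close> are linked without \<open>e\<close>, a simple path between them and \<open>e\<close> together form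
  a cycle. The edges of the path differ from each other because their pairs of ends differ, and
  from \<open>e\<close>, even if parallel to it, because the path avoids \<open>e\<close>.
\<close>
lemma acyclic_imp_forest:
  assumes F: "F \<subseteq> edges G" and ac: "acyclic_graph (G\<lparr>edges := F\<rparr>)"
  shows "forest G F"
  unfolding forest_def
proof (intro ballI allI impI notI)
  fix e u v
  assume e: "e \<in> F" "ends G e = {u, v}" and l: "linked G (F - {e}) u v"
  obtain vs where vs: "vs \<noteq> []" "hd vs = u" "last vs = v" "distinct vs"
    "successively (adjacent (G\<lparr>edges := F - {e}\<rparr>)) vs"
    using linked_imp_simple_path[OF l] by blast
  define m where "m = length vs - 1"
  have len: "length vs = Suc m" using vs(1) by (simp add: m_def)
  have uv: "u \<noteq> v" "u \<in> verts G" using ends_distinct ends_in_verts e F by blast+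
  have v0: "vs ! 0 = u" "vs ! m = v"
    using vs by (auto simp: hd_conv_nth last_conv_nth m_def)
  then have "m > 0" using uv by (cases m) auto
  have "\<forall>i<m. \<exists>d\<in>F - {e}. ends G d = {vs ! i, vs ! Suc i}"
    using vs(5) len by (auto simp: successively_conv_nth adjacent_edges_iff)
  then obtain d where d: "\<And>i. i < m \<Longrightarrow> d i \<in> F - {e} \<and> ends G (d i) = {vs ! i, vs ! Suc i}"
    by metis
  define es where "es = map d [0..<m] @ [e]"
  have nth: "es ! i = (if i < m then d i else e)" if "i < Suc m" for i
    using that by (auto simp: es_def nth_append)
  have "inj_on d {0..<m}"
  proof (rule inj_onI)
    fix i j assume ij: "i \<in> {0..<m}" "j \<in> {0..<m}" "d i = d j"
    then have "{vs ! i, vs ! Suc i} = {vs ! j, vs ! Suc j}"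
      using d by (metis atLeastLessThan_iff)
    then show "i = j"
      using ij vs(4) len by (auto simp: doubleton_eq_iff nth_eq_iff_index_eq)
  qed
  moreover have "e \<notin> d ` {0..<m}" using d by fastforce
  ultimately have "distinct es" by (auto simp: es_def distinct_map)
  moreover have "set es \<subseteq> F" using d e by (auto simp: es_def)
  moreover have "set vs \<subseteq> verts G"
  proof
    fix x assume "x \<in> set vs"
    then obtain i where i: "i \<le> m" "x = vs ! i" using len by (auto simp: in_set_conv_nth less_Suc_eq_le)
    show "x \<in> verts G"
    proof (cases i)
      case 0
      then show ?thesis using i v0 uv by simp
    next
      case (Suc j)
      then show ?thesis using i d[of j] F ends_in_verts[of "d j"] by auto
    qed
  qed
  moreover have "ends G (es ! i) = {vs ! i, vs ! (Suc i mod Suc m)}" if "i < Suc m" for i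
  proof (cases "i < m")
    case True
    then show ?thesis using d nth[of i] by simp
  next
    case False
    then have "i = m" using that by simp
    then show ?thesis using nth[of i] e v0 by (simp add: insert_commute)
  qed
  ultimately have "graph_cycle (G\<lparr>edges := F\<rparr>) vs es"
    using vs len unfolding graph_cycle_def by (auto simp: es_def)
  then show False using ac by (auto simp: acyclic_graph_def)
qed

text \<open>
  The last edge of a cycle is not a bridge: the other edges lead from one of its ends to the other.
\<close>
lemma forest_imp_acyclic:
  assumes F: "forest G F"
  shows "acyclic_graph (G\<lparr>edges := F\<rparr>)"
  unfolding acyclic_graph_def
proof clarify
  fix vs es
  assume c: "graph_cycle (G\<lparr>edges := F\<rparr>) vs es"
  define m where "m = length es - 1"
  define e where "e = es ! m"
  have len: "length es = Suc m" using c by (auto simp: graph_cycle_def m_def)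
  have ends: "ends G (es ! i) = {vs ! i, vs ! (Suc i mod Suc m)}" if "i < Suc m" for i
    using c that len by (simp add: graph_cycle_def)
  have eF: "e \<in> F" using c len by (auto simp: graph_cycle_def e_def)
  have "linked G (F - {e}) (vs ! 0) (vs ! i)" if "i \<le> m" for i
    using that
  proof (induction i)
    case (Suc i)
    have "es ! i \<in> F - {e}"
      using c len Suc.prems by (auto simp: graph_cycle_def e_def nth_eq_iff_index_eq)
    then have "linked G (F - {e}) (vs ! i) (vs ! Suc i)"
      using ends[of i] Suc.prems by (auto intro: linked_edge)
    then show ?case using Suc linked_trans by (metis Suc_leD)
  qed simp
  moreover have "ends G e = {vs ! 0, vs ! m}" using ends[of m] by (simp add: e_def insert_commute)
  ultimately show False using F eF unfolding forest_def by blast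
qed

lemma spanning_trees_iff:
  "\<gamma> \<in> spanning_trees G \<longleftrightarrow>
    \<gamma> \<subseteq> edges G \<and> forest G \<gamma> \<and> graph_connected (G\<lparr>edges := \<gamma>\<rparr>)"
  using acyclic_imp_forest forest_imp_acyclic
  by (auto simp: spanning_trees_def graph_tree_def)

lemma spanning_tree_edge: "\<gamma> \<in> spanning_trees G \<Longrightarrow> e \<in> \<gamma> \<Longrightarrow> e \<in> edges G"
  by (auto simp: spanning_trees_iff)

lemma finite_spanning_trees: "finite (spanning_trees G)"
  by (rule finite_subset[of _ "Pow (edges G)"]) (auto simp: spanning_trees_iff finite_edges)

lemma spanning_tree_linked:
  "\<gamma> \<in> spanning_trees G \<Longrightarrow> x \<in> verts G \<Longrightarrow> y \<in> verts G \<Longrightarrow> linked G \<gamma> x y"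
  by (auto simp: spanning_trees_iff graph_connected_def linked_def)

text \<open>
  The path of \<open>\<gamma>\<close> between the ends of \<open>d\<close> must use an edge of \<open>D\<close>, and any edge on that path may be
  exchanged for \<open>d\<close>. To find one without handling the path itself, take a smallest set
  \<open>S \<subseteq> \<gamma> \<inter> D\<close> which, added to \<open>\<gamma> - D\<close>, links the ends of \<open>d\<close>: each element of \<open>S\<close> is
  indispensable for this link, so it lies on the path.
\<close>
lemma spanning_tree_exchange:
  assumes \<gamma>: "\<gamma> \<in> spanning_trees G" and d: "d \<in> edges G" "ends G d = {a, b}"
    and nl: "\<not> linked G (\<gamma> - D) a b"
  shows "\<exists>e\<in>\<gamma> \<inter> D. insert d (\<gamma> - {e}) \<in> spanning_trees G"
proof -
  have finD: "finite (\<gamma> \<inter> D)"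
    using \<gamma> finite_edges by (meson finite_Int finite_subset spanning_trees_iff)
  have ab: "a \<in> verts G" "b \<in> verts G" using ends_in_verts d by blast+
  have "linked G (\<gamma> - D \<union> \<gamma> \<inter> D) a b"
    using spanning_tree_linked[OF \<gamma> ab] by (rule linked_mono) blast
  then obtain S where S: "S \<subseteq> \<gamma> \<inter> D" "linked G (\<gamma> - D \<union> S) a b"
    and least: "\<And>S'. S' \<subseteq> \<gamma> \<inter> D \<Longrightarrow> linked G (\<gamma> - D \<union> S') a b \<Longrightarrow> card S \<le> card S'"
    using ex_has_least_nat[of "\<lambda>S. S \<subseteq> \<gamma> \<inter> D \<and> linked G (\<gamma> - D \<union> S) a b" "\<gamma> \<inter> D" card]
    by auto
  have "S \<noteq> {}" using S(2) nl by auto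
  then obtain e where eS: "e \<in> S" by blast
  let ?F = "\<gamma> - D \<union> (S - {e})"
  have e: "e \<in> \<gamma>" "e \<in> D" "e \<in> edges G" using eS S(1) \<gamma> by (auto simp: spanning_trees_iff)
  obtain u v where uv: "ends G e = {u, v}" using edge_ends e by metis
  have F: "\<not> linked G ?F a b"
  proof
    assume "linked G ?F a b"
    then have "card S \<le> card (S - {e})" using S(1) by (intro least) auto
    moreover have "finite S" using S(1) finD by (rule finite_subset)
    ultimately show False using eS card_Diff1_less[of S e] by simp
  qed
  have "insert e ?F = \<gamma> - D \<union> S" using eS by blast
  then have ab_uv: "linked G ?F a u \<and> linked G ?F v b \<or> linked G ?F a v \<and> linked G ?F u b"
    using S(2) F linked_insert[OF uv] by metis
  have sub: "linked G ?F x y \<Longrightarrow> linked G (\<gamma> - {e}) x y" for x y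
    by (erule linked_mono) (use S(1) e in blast)
  have cut: "\<not> linked G (\<gamma> - {e}) u v" using \<gamma> e uv by (auto simp: spanning_trees_iff forest_def)
  \<comment> \<open>Otherwise \<open>u\<close>, \<open>a\<close>, \<open>b\<close>, \<open>v\<close> would be linked without \<open>e\<close>, in this order or with
      \<open>u\<close> and \<open>v\<close> swapped.\<close>
  then have nl': "\<not> linked G (\<gamma> - {e}) a b"
    using ab_uv sub linked_sym linked_trans by metis
  let ?T = "insert d (\<gamma> - {e})"
  have "forest G ?T"
    using \<gamma> forest_insert[OF _ d(2) nl'] forest_subset by (metis Diff_subset spanning_trees_iff)
  moreover have "linked G ?T x y" if xy: "x \<in> verts G" "y \<in> verts G" for x y
    using spanning_tree_linked[OF \<gamma> xy]
  proof (rule linked_if_edges_linked)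
    fix g p q assume g: "g \<in> \<gamma>" "ends G g = {p, q}"
    have uvT: "linked G ?T u v"
      using ab_uv sub linked_insert[OF d(2)] linked_sym by metis
    show "linked G ?T p q"
    proof (cases "g = e")
      case True
      then show ?thesis using uvT g uv linked_sym by (metis doubleton_eq_iff)
    next
      case False
      then show ?thesis using g by (auto intro: linked_edge)
    qed
  qed
  then have "graph_connected (G\<lparr>edges := ?T\<rparr>)"
    using ab by (auto simp: graph_connected_def linked_def)
  ultimately show ?thesis
    using e d \<gamma> by (auto simp: spanning_trees_iff)
qed

text \<open>
  Each added edge merges at most two components. If all edges involved are bridges, then every
  added edge merges exactly two, and the next lemma sharpens the bound to an equality.
\<close>
lemma card_components_Un_le:
  assumes "finite D" "D \<subseteq> edges G"
  shows "card (components G F) \<le> card (components G (F \<union> D)) + card D"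
  using assms
proof (induction D rule: finite_induct)
  case (insert e D)
  obtain u v where uv: "ends G e = {u, v}" "u \<in> verts G" "v \<in> verts G"
    using insert.prems edge_ends by (metis insert_subset)
  have "card (components G (F \<union> D)) \<le> Suc (card (components G (insert e (F \<union> D))))"
  proof (cases "linked G (F \<union> D) u v")
    case True
    have "linked G (insert e (F \<union> D)) x y \<longleftrightarrow> linked G (F \<union> D) x y" for x y
      using linked_insert[OF uv(1)] True linked_sym linked_trans by metis
    then have "components G (insert e (F \<union> D)) = components G (F \<union> D)"
      by (intro components_cong)
    then show ?thesis by simp
  next
    case False
    then show ?thesis using card_components_insert_bridge[OF finite_verts uv] by simp
  qed
  then show ?case using insert by simp
qed simp

lemma card_components_forest_Un:
  assumes "finite D" "D \<subseteq> edges G" "F \<inter> D = {}" "forest G (F \<union> D)"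
  shows "card (components G F) = card (components G (F \<union> D)) + card D"
  using assms
proof (induction D rule: finite_induct)
  case (insert e D)
  obtain u v where uv: "ends G e = {u, v}" "u \<in> verts G" "v \<in> verts G"
    using insert.prems edge_ends by (metis insert_subset)
  have "F \<union> insert e D - {e} = F \<union> D" using insert by auto
  then have "\<not> linked G (F \<union> D) u v"
    using insert.prems uv unfolding forest_def by (metis Un_iff insertI1)
  then have "card (components G (F \<union> D)) = Suc (card (components G (insert e (F \<union> D))))"
    by (rule card_components_insert_bridge[OF finite_verts uv])
  moreover have "forest G (F \<union> D)" using insert.prems forest_subset by blast
  ultimately show ?case using insert by simp
qed simp

section \<open>Spanning trees and partitions\<close>

text \<open>
  A path leaves a part of a partition only through a cut edge.
\<close>
lemma linked_avoiding_cut: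
  assumes Q: "partition_on (verts G) Q" and F: "F \<subseteq> edges G" "F \<inter> cut_edges G Q = {}"
    and U: "U \<in> Q" "x \<in> U" and l: "linked G F x y"
  shows "y \<in> U"
  using l
proof (induction rule: linked_induct)
  case refl
  show ?case by (fact U(2))
next
  case (step y z e)
  have e: "e \<in> edges G" "e \<notin> cut_edges G Q" using step F by auto
  then have "z \<in> verts G" using ends_in_verts step by blast
  then obtain W where "W \<in> Q" "z \<in> W" using Q by (auto simp: partition_on_def)
  then show ?case using e step U unfolding cut_edges_def by blast
qed

text \<open>
  Without its cut edges, \<open>\<gamma>\<close> has at least one component in each part of \<open>Q\<close>. Putting the cut
  edges back reduces this number to \<open>1\<close>, and each of them accounts for at most one step.
\<close>
lemma card_tree_cut_ge:
  assumes Q: "partition_on (verts G) Q" and \<gamma>: "\<gamma> \<in> spanning_trees G"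
  shows "card Q \<le> Suc (card (\<gamma> \<inter> cut_edges G Q))"
proof -
  let ?D = "cut_edges G Q"
  let ?F = "\<gamma> - ?D"
  have sub: "\<gamma> \<subseteq> edges G" using \<gamma> by (simp add: spanning_trees_iff)
  have "\<forall>U\<in>Q. \<exists>x. x \<in> U" using partition_onD3[OF Q] by (metis ex_in_conv)
  then obtain p where p: "\<And>U. U \<in> Q \<Longrightarrow> p U \<in> U" by metis
  have pV: "p U \<in> verts G" if "U \<in> Q" for U using Q p[OF that] that by (auto simp: partition_on_def)
  have "inj_on (\<lambda>U. component G ?F (p U)) Q"
  proof (rule inj_onI)
    fix U W assume UW: "U \<in> Q" "W \<in> Q" "component G ?F (p U) = component G ?F (p W)"
    then have "linked G ?F (p U) (p W)" using component_eq_iff pV by metis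
    then have "p W \<in> U" using linked_avoiding_cut[OF Q _ _ UW(1) p] UW sub by blast
    then show "U = W" using Q UW p partition_onD2 by (metis disjoint_iff disjointD)
  qed
  moreover have "finite (components G ?F)" using finite_verts by (simp add: components_def)
  ultimately have "card Q \<le> card (components G ?F)"
    using pV by (intro card_inj_on_le) (auto simp: components_def)
  also have "\<dots> \<le> card (components G (?F \<union> \<gamma> \<inter> ?D)) + card (\<gamma> \<inter> ?D)"
    using sub finite_edges by (intro card_components_Un_le) (auto intro: finite_subset)
  also have "?F \<union> \<gamma> \<inter> ?D = \<gamma>" by blast
  also have "card (components G \<gamma>) = 1"
    using \<gamma> by (intro card_components_eq_1) (simp add: spanning_trees_iff)
  finally show ?thesis by simp
qed

text \<open>
  A path in \<open>F\<close> never leaves the component where it starts, so its edges survive in the induced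
  subgraph.
\<close>
lemma component_connected:
  assumes F: "F \<subseteq> edges G" and U: "U \<in> components G F"
  shows "graph_connected (induced_subgraph G U)"
proof -
  obtain x where x: "x \<in> verts G" "U = component G F x" using U by (auto simp: components_def)
  let ?F = "{e \<in> edges G. ends G e \<subseteq> U}"
  have star: "linked G ?F x y" if "linked G F x y" for y
    using that
  proof (induction rule: linked_induct)
    case (step y z e)
    have "linked G F x z" using step linked_edge linked_trans by metis
    then have "e \<in> ?F" using step x F ends_in_verts[of e] by (auto simp: component_def)
    then show ?case using step linked_edge linked_trans by metis
  qed simp
  have "linked G ?F y z" if "y \<in> U" "z \<in> U" for y z
    using star that x linked_sym linked_trans by (metis (mono_tags) component_def mem_Collect_eq)
  moreover have "adjacent (induced_subgraph G U) = adjacent (G\<lparr>edges := ?F\<rparr>)"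
    by (intro ext) (simp add: adjacent_def induced_subgraph_def)
  moreover have "U \<noteq> {}" using x linked_refl by (auto simp: component_def)
  ultimately show ?thesis
    by (simp add: graph_connected_def linked_def) (simp add: induced_subgraph_def)
qed

section \<open>Edge probabilities and the overlap functional\<close>

lemma edge_prob_eq:
  "edge_prob G \<mu> e = (\<Sum>\<gamma>\<in>spanning_trees G. of_bool (e \<in> \<gamma>) * pmf \<mu> \<gamma>)"
  unfolding edge_prob_def sum.inter_filter[OF finite_spanning_trees]
  by (intro sum.cong) auto

text \<open>
  This is linearity of expectation: the edge probabilities of \<open>D\<close> add up to the mean number of
  edges of \<open>D\<close> in a random tree. It turns statements on trees into statements on \<open>\<eta>\<close>.
\<close>
lemma sum_edge_prob:
  assumes "D \<subseteq> edges G"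
  shows "(\<Sum>e\<in>D. edge_prob G \<mu> e) = (\<Sum>\<gamma>\<in>spanning_trees G. real (card (\<gamma> \<inter> D)) * pmf \<mu> \<gamma>)"
proof -
  have "finite D" using assms finite_edges finite_subset by blast
  then have card: "real (card (\<gamma> \<inter> D)) = (\<Sum>e\<in>D. of_bool (e \<in> \<gamma>))" for \<gamma>
    by (simp add: Int_commute Int_def)
  show ?thesis
    unfolding edge_prob_eq card sum_distrib_right by (rule sum.swap)
qed

text \<open>
  Two independent random trees both contain \<open>e\<close> with probability \<open>(edge_prob G \<mu> e)\<^sup>2\<close>.
\<close>
lemma expected_overlap_eq: "expected_overlap G \<mu> = (\<Sum>e\<in>edges G. (edge_prob G \<mu> e)\<^sup>2)"
proof -
  have card: "real (card (\<gamma> \<inter> \<gamma>')) = (\<Sum>e\<in>edges G. of_bool (e \<in> \<gamma>) * of_bool (e \<in> \<gamma>'))"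
    if "\<gamma> \<in> spanning_trees G" for \<gamma> \<gamma>'
  proof -
    have "\<gamma> \<inter> \<gamma>' = {e \<in> edges G. e \<in> \<gamma> \<and> e \<in> \<gamma>'}" using that by (auto simp: spanning_trees_iff)
    then show ?thesis using finite_edges by (simp add: Int_def flip: of_bool_conj)
  qed
  have "expected_overlap G \<mu> = (\<Sum>\<gamma>\<in>spanning_trees G. \<Sum>\<gamma>'\<in>spanning_trees G. \<Sum>e\<in>edges G.
      (of_bool (e \<in> \<gamma>) * pmf \<mu> \<gamma>) * (of_bool (e \<in> \<gamma>') * pmf \<mu> \<gamma>'))"
    unfolding expected_overlap_def
    by (intro sum.cong refl) (simp add: card sum_distrib_left sum_distrib_right mult_ac)
  also have "\<dots> = (\<Sum>e\<in>edges G. \<Sum>\<gamma>\<in>spanning_trees G. \<Sum>\<gamma>'\<in>spanning_trees G.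
      (of_bool (e \<in> \<gamma>) * pmf \<mu> \<gamma>) * (of_bool (e \<in> \<gamma>') * pmf \<mu> \<gamma>'))"
    by (subst (2) sum.swap, subst sum.swap) simp
  also have "\<dots> = (\<Sum>e\<in>edges G. (edge_prob G \<mu> e)\<^sup>2)"
    by (simp add: edge_prob_eq power2_eq_square sum_product)
  finally show ?thesis .
qed

text \<open>
  This is the first-order optimality condition along the direction that moves mass from \<open>\<gamma>\<close> to the
  exchanged tree. Only \<open>e\<close> and \<open>d\<close> change their probabilities, so the change of the objective
  has a closed form.
\<close>
lemma optimal_exchange:
  assumes opt: "meo_optimal G \<mu>" and \<gamma>: "\<gamma> \<in> set_pmf \<mu>"
    and ed: "e \<in> \<gamma>" "d \<notin> \<gamma>" and new: "insert d (\<gamma> - {e}) \<in> spanning_trees G"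
  shows "edge_prob G \<mu> e \<le> edge_prob G \<mu> d"
proof (rule ccontr)
  let ?\<gamma> = "insert d (\<gamma> - {e})" and ?\<eta> = "edge_prob G \<mu>"
  assume "\<not> ?\<eta> e \<le> ?\<eta> d"
  then have lt: "?\<eta> d < ?\<eta> e" by simp
  have supp: "set_pmf \<mu> \<subseteq> spanning_trees G"
    using opt by (auto simp: meo_optimal_def is_arg_min_def pmfs_on_def)
  have E: "e \<in> edges G" "d \<in> edges G"
    using supp \<gamma> new ed spanning_tree_edge by blast+
  have ne: "e \<noteq> d" "\<gamma> \<noteq> ?\<gamma>" using ed by auto
  \<comment> \<open>The mass \<open>t\<close> is available at \<open>\<gamma>\<close> and is below \<open>?\<eta> e - ?\<eta> d\<close>, where the change of the
      overlap becomes zero again.\<close>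
  define t where "t = min (pmf \<mu> \<gamma>) ((?\<eta> e - ?\<eta> d) / 2)"
  have t: "0 < t" "t \<le> pmf \<mu> \<gamma>" "t < ?\<eta> e - ?\<eta> d"
    using lt \<gamma> by (auto simp: t_def pmf_positive min_def field_simps)
  have "finite (set_pmf \<mu>)" using supp finite_spanning_trees finite_subset by blast
  then obtain \<nu> where \<nu>:
    "\<And>z. pmf \<nu> z = pmf \<mu> z - of_bool (z = \<gamma>) * t + of_bool (z = ?\<gamma>) * t"
    "set_pmf \<nu> \<subseteq> insert ?\<gamma> (set_pmf \<mu>)"
    using pmf_transfer_mass[of \<mu> \<gamma> ?\<gamma> t] ne t by (metis less_imp_le)
  have point: "(\<Sum>z\<in>spanning_trees G. of_bool (g \<in> z) * (of_bool (z = z0) * t)) = of_bool (g \<in> z0) * t"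
    if "z0 \<in> spanning_trees G" for z0 g
    using that finite_spanning_trees
    by (subst sum.mono_neutral_right[of _ "{z0}"]) auto
  have "edge_prob G \<nu> g = ?\<eta> g - of_bool (g \<in> \<gamma>) * t + of_bool (g \<in> ?\<gamma>) * t" for g
  proof -
    have "edge_prob G \<nu> g = ?\<eta> g -
        (\<Sum>z\<in>spanning_trees G. of_bool (g \<in> z) * (of_bool (z = \<gamma>) * t)) +
        (\<Sum>z\<in>spanning_trees G. of_bool (g \<in> z) * (of_bool (z = ?\<gamma>) * t))"
      by (simp only: edge_prob_eq \<nu>(1) sum.distrib sum_subtractf distrib_left right_diff_distrib)
    then show ?thesis using point \<gamma> supp new by (simp add: subsetD)
  qed
  then have \<eta>: "edge_prob G \<nu> g = ?\<eta> g - of_bool (g = e) * t + of_bool (g = d) * t" for g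
    using ed by auto
  let ?R = "edges G - {e, d}"
  have split: "(\<Sum>g\<in>edges G. h g) = h e + h d + (\<Sum>g\<in>?R. h g)" for h :: "'e \<Rightarrow> real"
  proof -
    have "(\<Sum>g\<in>edges G. h g) = (\<Sum>g\<in>?R. h g) + (\<Sum>g\<in>{e, d}. h g)"
      using E finite_edges by (intro sum.subset_diff) auto
    then show ?thesis using ne by simp
  qed
  have "(\<Sum>g\<in>?R. (edge_prob G \<nu> g)\<^sup>2) = (\<Sum>g\<in>?R. (?\<eta> g)\<^sup>2)"
    by (intro sum.cong) (auto simp: \<eta>)
  then have "expected_overlap G \<nu> - expected_overlap G \<mu> =
      (?\<eta> e - t)\<^sup>2 + (?\<eta> d + t)\<^sup>2 - (?\<eta> e)\<^sup>2 - (?\<eta> d)\<^sup>2"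
    using ne by (simp add: expected_overlap_eq split \<eta>)
  also have "\<dots> = 2 * t * (t - (?\<eta> e - ?\<eta> d))"
    by (simp add: power2_eq_square algebra_simps)
  also have "\<dots> < 0" using t by (simp add: mult_pos_neg)
  finally have "expected_overlap G \<nu> < expected_overlap G \<mu>" by simp
  moreover have "\<nu> \<in> pmfs_on (spanning_trees G)"
    using \<nu>(2) supp new by (auto simp: pmfs_on_def)
  ultimately show False
    using opt by (auto simp: meo_optimal_def is_arg_min_def)
qed

end

section \<open>The components left by the most likely edges\<close>

theorem theorem4p10:
  fixes G :: "('v, 'e) multigraph"
    and \<mu> :: "'e set pmf"
    and K :: real
    and Estar :: "'e set"
  assumes "finite_multigraph G"
    and "loopless G"
    and "graph_connected G"
    and "edges G \<noteq> {}"
    and "meo_optimal G \<mu>"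
    and "K = (MAX e\<in>edges G. edge_prob G \<mu> e)"
    and "Estar = {e \<in> edges G. edge_prob G \<mu> e = K}"
  shows "\<exists>P. feasible_partition G P \<and>
           Estar = cut_edges G P \<and>
           (\<forall>\<gamma>\<in>set_pmf \<mu>. card (\<gamma> \<inter> cut_edges G P) = card P - 1) \<and>
           (\<forall>e\<in>cut_edges G P. edge_prob G \<mu> e = K \<and> K = inverse (partition_weight G P)) \<and>
           partition_weight G P = (MIN Q\<in>{Q. feasible_partition G Q}. partition_weight G Q)"
proof -
  interpret finite_loopless_multigraph G
    using assms by unfold_locales
  let ?\<eta> = "edge_prob G \<mu>" and ?F = "edges G - Estar"
  define P where "P = components G ?F"
  have supp: "set_pmf \<mu> \<subseteq> spanning_trees G"
    using \<open>meo_optimal G \<mu>\<close> by (auto simp: meo_optimal_def is_arg_min_def pmfs_on_def)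
  have sum1: "(\<Sum>\<gamma>\<in>spanning_trees G. pmf \<mu> \<gamma>) = 1"
    using supp finite_spanning_trees by (rule_tac sum_pmf_eq_1)
  have le_K: "?\<eta> e \<le> K" if "e \<in> edges G" for e
    using that finite_edges unfolding \<open>K = _\<close> by simp
  have "K \<in> ?\<eta> ` edges G"
    unfolding \<open>K = _\<close> using finite_edges \<open>edges G \<noteq> {}\<close> by (intro Max_in) auto
  then obtain e0 where e0: "e0 \<in> edges G" "?\<eta> e0 = K" by auto

  \<comment> \<open>There are two vertices, so a tree of the support has an edge, which has positive probability.\<close>
  have K_pos: "K > 0"
  proof -
    obtain \<gamma> where \<gamma>: "\<gamma> \<in> set_pmf \<mu>" using set_pmf_not_empty by fast
    obtain u v where uv: "u \<noteq> v" "u \<in> verts G" "v \<in> verts G" using e0 by (metis edge_ends)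
    have "linked G \<gamma> u v" using spanning_tree_linked supp \<gamma> uv by blast
    then have "\<gamma> \<noteq> {}" using uv by (auto simp: linked_def adjacent_def elim: rtranclp.cases)
    then obtain g where g: "g \<in> \<gamma>" by blast
    have "0 < pmf \<mu> \<gamma>" using \<gamma> by (rule pmf_positive)
    also have "pmf \<mu> \<gamma> \<le> ?\<eta> g"
      unfolding edge_prob_def using supp \<gamma> g finite_spanning_trees
      by (intro member_le_sum) auto
    also have "\<dots> \<le> K" using g \<gamma> supp le_K spanning_tree_edge by blast
    finally show ?thesis .
  qed

  \<comment> \<open>The trees of the support are minimum spanning trees for \<open>?\<eta>\<close>, and \<open>Estar\<close> is the set
      of heaviest edges.\<close>
  have kruskal: "linked G (\<gamma> - Estar) x y \<longleftrightarrow> linked G ?F x y" if \<gamma>: "\<gamma> \<in> set_pmf \<mu>" for \<gamma> x y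
  proof
    have T: "\<gamma> \<in> spanning_trees G" using \<gamma> supp by blast
    show "linked G (\<gamma> - Estar) x y \<Longrightarrow> linked G ?F x y"
      by (erule linked_mono) (use T in \<open>auto simp: spanning_trees_iff\<close>)
    show "linked G ?F x y \<Longrightarrow> linked G (\<gamma> - Estar) x y"
    proof (erule linked_if_edges_linked, rule ccontr)
      fix d a b
      assume d: "d \<in> ?F" "ends G d = {a, b}" and nl: "\<not> linked G (\<gamma> - Estar) a b"
      then obtain e where e: "e \<in> \<gamma>" "e \<in> Estar" "insert d (\<gamma> - {e}) \<in> spanning_trees G"
        using spanning_tree_exchange[OF T _ d(2) nl] by blast
      have "d \<notin> \<gamma>" using nl d by (auto intro: linked_edge)
      then have "?\<eta> e \<le> ?\<eta> d"
        using optimal_exchange[OF \<open>meo_optimal G \<mu>\<close> \<gamma>] e by blast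
      then show False using e d le_K[of d] \<open>Estar = _\<close> by auto
    qed
  qed

  \<comment> \<open>Such an edge would close a cycle in a tree of the support that contains it.\<close>
  have not_linked: "\<not> linked G ?F u v" if e: "e \<in> Estar" "ends G e = {u, v}" for e u v
  proof
    assume l: "linked G ?F u v"
    have "?\<eta> e \<noteq> 0" using e K_pos \<open>Estar = _\<close> by auto
    then obtain \<gamma> where \<gamma>: "\<gamma> \<in> spanning_trees G" "e \<in> \<gamma>" "pmf \<mu> \<gamma> \<noteq> 0"
      unfolding edge_prob_def using sum.neutral by (metis (mono_tags, lifting) mem_Collect_eq)
    then have "linked G (\<gamma> - Estar) u v" using kruskal l by (simp add: set_pmf_iff)
    then have "linked G (\<gamma> - {e}) u v" by (rule linked_mono) (use e in blast)
    then show False using \<gamma> e by (auto simp: spanning_trees_iff forest_def)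
  qed

  have part: "partition_on (verts G) P" unfolding P_def by (rule partition_on_components)
  have cut: "cut_edges G P = Estar"
  proof (intro subset_antisym subsetI)
    fix e assume "e \<in> cut_edges G P"
    then obtain U W u w where e: "e \<in> edges G" "U \<in> P" "W \<in> P" "U \<noteq> W" "u \<in> U" "w \<in> W"
      "ends G e = {u, w}" by (auto simp: cut_edges_def)
    show "e \<in> Estar"
    proof (rule ccontr)
      assume "e \<notin> Estar"
      then have l: "linked G ?F u w" using e by (auto intro: linked_edge)
      have "U = component G ?F u" "W = component G ?F w"
        using e component_of_member unfolding P_def by metis+
      then show False using l e ends_in_verts component_eq_iff by metis
    qed
  next
    fix e assume e: "e \<in> Estar"
    then have eE: "e \<in> edges G" using \<open>Estar = _\<close> by simp
    obtain u v where uv: "ends G e = {u, v}" "u \<in> verts G" "v \<in> verts G" using eE by (metis edge_ends)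
    have "component G ?F u \<noteq> component G ?F v"
      using not_linked[OF e uv(1)] component_eq_iff uv by metis
    moreover have "component G ?F u \<in> P" "component G ?F v \<in> P"
      using uv by (auto simp: P_def components_def)
    moreover have "u \<in> component G ?F u" "v \<in> component G ?F v"
      using uv by (auto simp: component_def)
    ultimately show "e \<in> cut_edges G P" unfolding cut_edges_def using eE uv(1) by blast
  qed
  have Esub: "Estar \<subseteq> edges G" using \<open>Estar = _\<close> by auto

  \<comment> \<open>The edges of \<open>\<gamma> \<inter> Estar\<close> join the components of \<open>\<gamma> - Estar\<close>, which are the parts of \<open>P\<close>,
      into one, and no edge is wasted since \<open>\<gamma>\<close> is a forest.\<close>
  have cross: "card P = Suc (card (\<gamma> \<inter> Estar))" if \<gamma>: "\<gamma> \<in> set_pmf \<mu>" for \<gamma>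
  proof -
    have T: "\<gamma> \<in> spanning_trees G" using \<gamma> supp by blast
    have "P = components G (\<gamma> - Estar)"
      unfolding P_def by (rule components_cong) (simp add: kruskal \<gamma>)
    then have "card P = card (components G (\<gamma> - Estar \<union> \<gamma> \<inter> Estar)) + card (\<gamma> \<inter> Estar)"
      using T Esub finite_edges
      by (simp only:, intro card_components_forest_Un)
        (auto simp: spanning_trees_iff Un_Diff_Int intro: finite_subset)
    also have "\<gamma> - Estar \<union> \<gamma> \<inter> Estar = \<gamma>" by blast
    also have "card (components G \<gamma>) = 1"
      using T by (intro card_components_eq_1) (simp add: spanning_trees_iff)
    finally show ?thesis by simp
  qed

  have "card P \<ge> 2"
  proof -
    have "e0 \<in> cut_edges G P" using cut e0 \<open>Estar = _\<close> by simp
    then obtain U W where UW: "U \<in> P" "W \<in> P" "U \<noteq> W" by (auto simp: cut_edges_def)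
    have "finite P" using finite_verts by (simp add: P_def components_def)
    then have "card {U, W} \<le> card P" using UW by (intro card_mono) auto
    then show ?thesis using UW by simp
  qed
  then have feas: "feasible_partition G P"
    using part component_connected[of ?F] by (auto simp: feasible_partition_def P_def)

  \<comment> \<open>The mean number of edges of \<open>Estar\<close> in a random tree, computed in two ways.\<close>
  have "real (card Estar) * K = (\<Sum>e\<in>Estar. ?\<eta> e)" using \<open>Estar = _\<close> by simp
  also have "\<dots> = (\<Sum>\<gamma>\<in>spanning_trees G. real (card (\<gamma> \<inter> Estar)) * pmf \<mu> \<gamma>)"
    by (rule sum_edge_prob[OF Esub])
  also have "\<dots> = (\<Sum>\<gamma>\<in>spanning_trees G. (real (card P) - 1) * pmf \<mu> \<gamma>)"
  proof (intro sum.cong refl)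
    fix \<gamma>
    show "real (card (\<gamma> \<inter> Estar)) * pmf \<mu> \<gamma> = (real (card P) - 1) * pmf \<mu> \<gamma>"
      using cross[of \<gamma>] by (cases "\<gamma> \<in> set_pmf \<mu>") (auto simp: set_pmf_iff)
  qed
  also have "\<dots> = real (card P) - 1" by (simp add: sum1 flip: sum_distrib_left)
  finally have eqK: "real (card Estar) * K = real (card P) - 1" .
  have weight: "partition_weight G P = inverse K"
    using eqK K_pos \<open>card P \<ge> 2\<close> by (simp add: partition_weight_def cut field_simps)

  have min: "partition_weight G P \<le> partition_weight G Q" if Q: "feasible_partition G Q" for Q
  proof -
    let ?D = "cut_edges G Q"
    have D: "?D \<subseteq> edges G" by (auto simp: cut_edges_def)
    have Q': "partition_on (verts G) Q" "card Q \<ge> 2" using Q by (auto simp: feasible_partition_def)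
    have "real (card Q) - 1 = (\<Sum>\<gamma>\<in>spanning_trees G. (real (card Q) - 1) * pmf \<mu> \<gamma>)"
      by (simp add: sum1 flip: sum_distrib_left)
    also have "\<dots> \<le> (\<Sum>\<gamma>\<in>spanning_trees G. real (card (\<gamma> \<inter> ?D)) * pmf \<mu> \<gamma>)"
      using card_tree_cut_ge[OF Q'(1)] by (intro sum_mono mult_right_mono) (force simp: algebra_simps)+
    also have "\<dots> = (\<Sum>e\<in>?D. ?\<eta> e)" by (rule sum_edge_prob[OF D, symmetric])
    also have "\<dots> \<le> (\<Sum>e\<in>?D. K)" using le_K D by (intro sum_mono) auto
    finally have "real (card Q) - 1 \<le> real (card ?D) * K" by simp
    then show ?thesis
      unfolding weight using K_pos Q'(2) by (simp add: partition_weight_def field_simps)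
  qed
  have "finite {Q. feasible_partition G Q}"
    by (rule finite_subset[of _ "Pow (Pow (verts G))"])
      (auto simp: feasible_partition_def partition_on_def finite_verts)
  then have is_min: "partition_weight G P = (MIN Q\<in>{Q. feasible_partition G Q}. partition_weight G Q)"
    using min feas by (intro Min_eqI[symmetric]) auto
  have "K = inverse (partition_weight G P)" using weight by simp
  moreover have "?\<eta> e = K" if "e \<in> cut_edges G P" for e
    using that cut \<open>Estar = _\<close> by simp
  moreover have "card (\<gamma> \<inter> cut_edges G P) = card P - 1" if "\<gamma> \<in> set_pmf \<mu>" for \<gamma>
    using cross[OF that] cut by simp
  ultimately show ?thesis using feas cut[symmetric] is_min by blast
qed

end
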